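(* Let $G$ be a structured bilinear SISO system given by $\mathcal{C},\mathcal{K},\mathcal{N},\mathcal{B}$, with subsystem transfer functions $G_k$, and let $\widehat G$, with subsystem transfer functions $\widehat G_k$, be the reduced-order bilinear SISO system constructed by projection with $W,V\in\mathbb{C}^{n\times r}$. Let $\sigma_1,\ldots,\sigma_k\in\mathbb{C}$ be interpolation points at which the matrix functions $\mathcal{C}(s)$, $\mathcal{K}(s)^{-1}$, $\mathcal{N}(s)$ and $\mathcal{B}(s)$ are defined and $\widehat{\mathcal{K}}(s)$ is full-rank. Let \[ v_1=\mathcal{K}(\sigma_1)^{-1}\mathcal{B}(\sigma_1),\qquad v_j=\mathcal{K}(\sigma_j)^{-1}\mathcal{N}(\sigma_{j-1})v_{j-1},\quad 2\le j\le k, \] let $V$ be such that $\operatorname{span}(V)\supseteq\operatorname{span}([v_1,\ldots,v_k])$, and let $W$ be an arbitrary full-rank truncation matrix of appropriate dimension. Then \[ G_1(\sigma_1)=\widehat G_1(\sigma_1),\quad G_2(\sigma_1,\sigma_2)=\widehat G_2(\sigma_1,\sigma_2),\quad\ldots,\quad G_k(\sigma_1,\ldots,\sigma_k)=\widehat G_k(\sigma_1,\ldots,\sigma_k). \]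
   Context: A structured bilinear SISO (single-input single-output) system $G$ is described by matrix-valued functions of a complex variable $\mathcal{C}\colon\mathbb{C}\to\mathbb{C}^{1\times n}$, $\mathcal{K}\colon\mathbb{C}\to\mathbb{C}^{n\times n}$, $\mathcal{N}\colon\mathbb{C}\to\mathbb{C}^{n\times n}$, $\mathcal{B}\colon\mathbb{C}\to\mathbb{C}^{n\times 1}$ (which may fail to be defined, or $\mathcal{K}$ may fail to be invertible, at some points), through its regular subsystem transfer functions \[ G_k(s_1,\ldots,s_k)=\mathcal{C}(s_k)\mathcal{K}(s_k)^{-1}\Big(\prod_{j=1}^{k-1}\mathcal{N}(s_{k-j})\mathcal{K}(s_{k-j})^{-1}\Big)\mathcal{B}(s_1),\qquad k\ge 1 . \] Products $\prod_{j=1}^{m}A_j$ of matrices are ordered $A_1A_2\cdots A_m$; empty products are identities. Given model reduction bases (truncation matrices) $W,V\in\mathbb{C}^{n\times r}$, the reduced-order system $\widehat G$ is given by \[ \widehat{\mathcal{C}}(s)=\mathcal{C}(s)V,\quad \widehat{\mathcal{K}}(s)=W^{\mathsf H}\mathcal{K}(s)V,\quad \widehat{\mathcal{B}}(s)=W^{\mathsf H}\mathcal{B}(s),\quad \widehat{\mathcal{N}}(s)=W^{\mathsf H}\mathcal{N}(s)V, \] and its transfer functions $\widehat G_k$ are defined by the same formula with hatted quantities. Here $^{\mathsf H}$ is the conjugate transpose and $\operatorname{span}$ of a matrix is its column space. *)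

theory Defs
  imports "HOL-Analysis.Analysis"
begin

text \<open>
  A matrix in \<open>\<complex>\<^sup>m\<^sup>\<times>\<^sup>n\<close> has type \<open>complex^'n^'m\<close> (rows are indexed by the outer
  type). The matrix functions of a system may be undefined at some points, so they are partial.
\<close>

record ('n::finite) bilinear_system =
  sysC :: "complex \<rightharpoonup> complex^'n^1"
  sysK :: "complex \<rightharpoonup> complex^'n^'n"
  sysN :: "complex \<rightharpoonup> complex^'n^'n"
  sysB :: "complex \<rightharpoonup> complex^1^'n"

definition conj_transpose :: "complex^'n^'m \<Rightarrow> complex^'m^'n"  (\<open>(_\<^sup>H)\<close> [1000] 999)
  where "A\<^sup>H = (\<chi> i j. cnj (A $ j $ i))"

definition full_rank :: "complex^'n^'m \<Rightarrow> bool"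
  where "full_rank A \<longleftrightarrow> rank A = min CARD('m) CARD('n)"

text \<open>
  The span is taken over \<open>\<complex>\<close>, hence \<^const>\<open>vec.span\<close>; the plain \<^const>\<open>span\<close> on
  \<open>complex^'m\<close> is the real span.
\<close>

definition column_space :: "complex^'n^'m \<Rightarrow> (complex^'m) set"
  where "column_space A = vec.span (columns A)"

definition Kinv :: "'n::finite bilinear_system \<Rightarrow> (complex \<rightharpoonup> complex^'n^'n)"
  where "Kinv G s =
    (case sysK G s of
       None \<Rightarrow> None
     | Some K \<Rightarrow> if invertible K then Some (matrix_inv K) else None)"

text \<open>
  The ordered product \<open>A 1 ** A 2 ** \<dots> ** A m\<close>. The multiplication of the type
  \<open>complex^'n^'n\<close> is componentwise, so \<^const>\<open>prod_list\<close> would not be the matrix product.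
\<close>

primrec matrix_prod :: "(nat \<Rightarrow> complex^'n^'n) \<Rightarrow> nat \<Rightarrow> complex^'n^'n"
  where
    "matrix_prod A 0 = mat 1"
  | "matrix_prod A (Suc m) = matrix_prod A m ** A (Suc m)"

text \<open>
  The arguments \<open>s\<^sub>1, \<dots>, s\<^sub>k\<close> of the \<open>k\<close>-th transfer function are the values of
  \<open>s\<close> at \<open>1, \<dots>, k\<close>; the transfer function is defined where every factor of its formula is.
\<close>

definition transfer_defined :: "'n::finite bilinear_system \<Rightarrow> nat \<Rightarrow> (nat \<Rightarrow> complex) \<Rightarrow> bool"
  where "transfer_defined G k s \<longleftrightarrow>
    1 \<le> k \<and> s k \<in> dom (sysC G) \<and> s 1 \<in> dom (sysB G) \<and>
    (\<forall>i\<in>{1..k}. s i \<in> dom (Kinv G)) \<and> (\<forall>i\<in>{1..<k}. s i \<in> dom (sysN G))"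

definition transfer_function ::
    "'n::finite bilinear_system \<Rightarrow> nat \<Rightarrow> (nat \<Rightarrow> complex) \<Rightarrow> (complex^1^1) option"
  where "transfer_function G k s =
    (if transfer_defined G k s
     then Some (the (sysC G (s k)) ** the (Kinv G (s k))
            ** matrix_prod (\<lambda>j. the (sysN G (s (k - j))) ** the (Kinv G (s (k - j)))) (k - 1)
            ** the (sysB G (s 1)))
     else None)"

definition reduced_system ::
    "complex^'r^'n \<Rightarrow> complex^'r^'n \<Rightarrow> 'n::finite bilinear_system \<Rightarrow> 'r::finite bilinear_system"
  where "reduced_system W V G =
    \<lparr> sysC = (\<lambda>s. map_option (\<lambda>C. C ** V) (sysC G s)),
      sysK = (\<lambda>s. map_option (\<lambda>K. W\<^sup>H ** K ** V) (sysK G s)),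
      sysN = (\<lambda>s. map_option (\<lambda>N. W\<^sup>H ** N ** V) (sysN G s)),
      sysB = (\<lambda>s. map_option (\<lambda>B. W\<^sup>H ** B) (sysB G s)) \<rparr>"

end

theory Submission
  imports Defs
begin

text \<open>
  Each \<open>v\<^sub>j\<close> lies in the column space of \<open>V\<close>, say \<open>v\<^sub>j = V x\<^sub>j\<close>. Multiplying
  \<open>K(\<sigma>\<^sub>j) v\<^sub>j = N(\<sigma>\<^sub>j\<^sub>-\<^sub>1) v\<^sub>j\<^sub>-\<^sub>1\<close> by \<open>W\<^sup>H\<close> shows that the coordinates \<open>x\<^sub>j\<close> satisfy the
  recursion of the reduced system, whose \<open>j\<close>-th transfer function is therefore
  \<open>C(\<sigma>\<^sub>j) V x\<^sub>j = C(\<sigma>\<^sub>j) v\<^sub>j\<close>.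
\<close>

text \<open>Full rank makes the rows span the whole space, which gives a left inverse; for a square
  matrix that suffices. This turns the rank hypothesis on the reduced \<open>K\<close> into
  membership in the domain of \<open>Kinv\<close>.\<close>

lemma full_rank_square_invertible:
  fixes A :: "complex^'n^'n"
  assumes "full_rank A"
  shows "invertible A"
proof -
  have "vec.dim (rows A) = CARD('n)"
    using assms by (simp add: full_rank_def row_rank_def_gen)
  then have "vec.span (rows A) = UNIV"
    using vec.dim_eq_full[of "rows A"] by (simp add: vec.dimension_def card_cart_basis)
  then show ?thesis
    by (simp add: invertible_left_inverse matrix_left_invertible_span_rows_gen)
qed

lemma matrix_inv_inverse:
  assumes "invertible A"
  shows "A ** matrix_inv A = mat 1" "matrix_inv A ** A = mat 1"
  using someI_ex[OF assms[unfolded invertible_def]] by (simp_all add: matrix_inv_def)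

lemma column_space_factor:
  fixes Y :: "complex^'m^'n" and V :: "complex^'r^'n"
  assumes "columns Y \<subseteq> column_space V"
  shows "\<exists>X. Y = V ** X"
proof -
  have "vec.subspace (range ((*v) V))"
    by (rule vec.subspace_image) simp
  moreover have "column i V = V *v axis i 1" for i
    by (simp add: vec_eq_iff column_def matrix_vector_mult_def axis_def if_distrib cong: if_cong)
  then have "columns V \<subseteq> range ((*v) V)"
    by (auto simp: columns_def)
  ultimately have "column_space V \<subseteq> range ((*v) V)"
    unfolding column_space_def by (rule vec.span_minimal[rotated])
  then have "\<forall>c. \<exists>x. column c Y = V *v x"
    using assms by (fastforce simp: columns_def)
  then obtain x where x: "\<And>c. column c Y = V *v x c"
    by metis
  have "Y = V ** (\<chi> i c. x c $ i)"
    using x by (simp add: vec_eq_iff column_def matrix_vector_mult_def matrix_matrix_mult_def)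
  then show ?thesis ..
qed

text \<open>\<open>matrix_prod\<close> recurses on its last factor, while raising the order of a
  transfer function adds a factor in front.\<close>

lemma matrix_prod_Suc_left:
  "matrix_prod A (Suc m) = A 1 ** matrix_prod (\<lambda>j. A (Suc j)) m"
  by (induction m) (simp_all add: matrix_mul_assoc)

text \<open>Here \<open>K\<close> stands for the inverses. The latest step of the state recursion
  supplies the leftmost factors of the product, so induction on \<open>m\<close> peels them
  off.\<close>

lemma transfer_product_state:
  fixes K N :: "nat \<Rightarrow> complex^'n^'n" and B :: "complex^1^'n"
  assumes "x 1 = K 1 ** B"
    and "\<And>j. j \<in> {2..Suc m} \<Longrightarrow> x j = K j ** N (j - 1) ** x (j - 1)"
  shows "K (Suc m) ** matrix_prod (\<lambda>j. N (Suc m - j) ** K (Suc m - j)) m ** B = x (Suc m)"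
  using assms(2)
proof (induction m)
  case 0
  then show ?case using assms(1) by simp
next
  case (Suc m)
  have "x (Suc (Suc m)) = K (Suc (Suc m)) ** N (Suc m) ** x (Suc m)"
    using Suc.prems[of "Suc (Suc m)"] by simp
  also have "x (Suc m) = K (Suc m) ** matrix_prod (\<lambda>j. N (Suc m - j) ** K (Suc m - j)) m ** B"
    using Suc.IH Suc.prems by simp
  \<comment> \<open>Since \<open>Suc (Suc m) - Suc j = Suc m - j\<close>, what remains after the
    first factor is the product of the induction hypothesis.\<close>
  finally show ?case
    by (simp add: matrix_prod_Suc_left matrix_mul_assoc del: matrix_prod.simps)
qed

text \<open>Serves twice: for \<open>G\<close> with the states \<open>v\<close>, and for the reduced
  system with their coordinates.\<close>

lemma transfer_function_state:
  assumes "transfer_defined G k s"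
    and "x 1 = the (Kinv G (s 1)) ** the (sysB G (s 1))"
    and "\<And>j. j \<in> {2..k} \<Longrightarrow>
      x j = the (Kinv G (s j)) ** the (sysN G (s (j - 1))) ** x (j - 1)"
  shows "transfer_function G k s = Some (the (sysC G (s k)) ** x k)"
proof -
  obtain m where k: "k = Suc m"
    using assms(1) by (cases k) (auto simp: transfer_defined_def)
  show ?thesis
    using assms transfer_product_state[of x "\<lambda>j. the (Kinv G (s j))" "the (sysB G (s 1))" m
        "\<lambda>j. the (sysN G (s j))"]
    by (simp add: k transfer_function_def flip: matrix_mul_assoc)
qed

lemma Kinv_SomeD:
  assumes "Kinv G s = Some L"
  obtains K where "sysK G s = Some K" "K ** L = mat 1" "L ** K = mat 1"
  using assms matrix_inv_inverse by (auto simp: Kinv_def split: option.splits if_splits)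

text \<open>As \<open>V ** x\<close> solves the full equation with right-hand side \<open>b\<close>,
  multiplying by \<open>W\<^sup>H\<close> gives
  \<open>(W\<^sup>H ** K ** V) ** x = W\<^sup>H ** b\<close>, and \<open>Lr\<close> isolates
  \<open>x\<close>.\<close>

lemma projected_solution:
  assumes "Kinv G s = Some L" and "Kinv (reduced_system W V G) s = Some Lr"
    and "V ** x = L ** b"
  shows "x = Lr ** (W\<^sup>H ** b)"
proof -
  obtain K where K: "sysK G s = Some K" "K ** L = mat 1"
    using assms(1) by (rule Kinv_SomeD)
  have "Lr ** (W\<^sup>H ** K ** V) = mat 1"
    using Kinv_SomeD[OF assms(2)] K(1) by (auto simp: reduced_system_def)
  then have "x = Lr ** (W\<^sup>H ** K ** V) ** x"
    by simp
  also have "\<dots> = Lr ** (W\<^sup>H ** (K ** (V ** x)))"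
    by (simp add: matrix_mul_assoc)
  also have "K ** (V ** x) = b"
    using K(2) assms(3) by (simp add: matrix_mul_assoc)
  finally show ?thesis .
qed

theorem theorem1:
  fixes G :: "'n::finite bilinear_system"
    and W V :: "complex^'r::finite^'n"
    and k :: nat
    and \<sigma> :: "nat \<Rightarrow> complex"
    and v :: "nat \<Rightarrow> complex^1^'n"
  assumes "1 \<le> k"
    and "\<And>i. i \<in> {1..k} \<Longrightarrow>
           \<sigma> i \<in> dom (sysC G) \<and> \<sigma> i \<in> dom (Kinv G) \<and> \<sigma> i \<in> dom (sysN G) \<and> \<sigma> i \<in> dom (sysB G)"
    and "\<And>i. i \<in> {1..k} \<Longrightarrow>
           \<exists>Kr. sysK (reduced_system W V G) (\<sigma> i) = Some Kr \<and> full_rank Kr"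
    and "v 1 = the (Kinv G (\<sigma> 1)) ** the (sysB G (\<sigma> 1))"
    and "\<And>j. j \<in> {2..k} \<Longrightarrow>
           v j = the (Kinv G (\<sigma> j)) ** the (sysN G (\<sigma> (j - 1))) ** v (j - 1)"
    and "vec.span (\<Union>j\<in>{1..k}. columns (v j)) \<subseteq> column_space V"
    and "full_rank W"
  shows "\<forall>j\<in>{1..k}. \<exists>g. transfer_function G j \<sigma> = Some g \<and>
                       transfer_function (reduced_system W V G) j \<sigma> = Some g"
proof
  let ?R = "reduced_system W V G"
  have dom_Kr: "\<sigma> i \<in> dom (Kinv ?R)" if "i \<in> {1..k}" for i
    using assms(3)[OF that] full_rank_square_invertible by (auto simp: Kinv_def)
  have "\<exists>x. v j = V ** x" if "j \<in> {1..k}" for j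
  proof (rule column_space_factor)
    show "columns (v j) \<subseteq> column_space V"
      using that assms(6) vec.span_superset[of "\<Union>j\<in>{1..k}. columns (v j)"] by blast
  qed
  then obtain x where x: "\<And>j. j \<in> {1..k} \<Longrightarrow> v j = V ** x j"
    by metis
  \<comment> \<open>The right-hand side \<open>b\<close> stays open: it is \<open>B\<close> for the
    first state and \<open>N\<close> times the previous state afterwards.\<close>
  have x_solves: "x i = the (Kinv ?R (\<sigma> i)) ** (W\<^sup>H ** b)"
    if i: "i \<in> {1..k}" and v: "v i = the (Kinv G (\<sigma> i)) ** b" for i b
    using projected_solution[of G "\<sigma> i" _ W V _ "x i" b] assms(2)[OF i] dom_Kr[OF i] x[OF i] v
    by auto
  have x_1: "x 1 = the (Kinv ?R (\<sigma> 1)) ** the (sysB ?R (\<sigma> 1))"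
    using x_solves[of 1, OF _ assms(4)] assms(1) assms(2)[of 1] by (auto simp: reduced_system_def)
  have x_step: "x i = the (Kinv ?R (\<sigma> i)) ** the (sysN ?R (\<sigma> (i - 1))) ** x (i - 1)"
    if i: "i \<in> {2..k}" for i
  proof -
    \<comment> \<open>Writing the previous state as \<open>V ** x (i - 1)\<close> puts
      \<open>V\<close> to the right of \<open>N\<close>, so that multiplying by
      \<open>W\<^sup>H\<close> produces the reduced \<open>N\<close>.\<close>
    have "v i = the (Kinv G (\<sigma> i)) ** (the (sysN G (\<sigma> (i - 1))) ** (V ** x (i - 1)))"
      using assms(5)[OF i] x[of "i - 1"] i by (fastforce simp flip: matrix_mul_assoc)
    then have "x i = the (Kinv ?R (\<sigma> i)) ** (W\<^sup>H ** (the (sysN G (\<sigma> (i - 1))) ** (V ** x (i - 1))))"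
      using i by (intro x_solves) auto
    moreover have "the (sysN ?R (\<sigma> (i - 1))) = W\<^sup>H ** the (sysN G (\<sigma> (i - 1))) ** V"
      using i assms(2)[of "i - 1"] by (fastforce simp: reduced_system_def)
    ultimately show ?thesis
      by (simp add: matrix_mul_assoc)
  qed
  fix j assume j: "j \<in> {1..k}"
  have "transfer_defined G j \<sigma>"
    using j assms(2) by (auto simp: transfer_defined_def)
  then have "transfer_function G j \<sigma> = Some (the (sysC G (\<sigma> j)) ** v j)"
    using j assms(4,5) by (intro transfer_function_state) auto
  moreover have "transfer_defined ?R j \<sigma>"
    using j assms(2) dom_Kr by (auto simp: transfer_defined_def reduced_system_def domIff)
  then have "transfer_function ?R j \<sigma> = Some (the (sysC ?R (\<sigma> j)) ** x j)"
    using j x_1 x_step by (intro transfer_function_state) auto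
  moreover have "the (sysC ?R (\<sigma> j)) ** x j = the (sysC G (\<sigma> j)) ** v j"
    using j assms(2)[OF j] x[OF j] by (auto simp: reduced_system_def matrix_mul_assoc)
  ultimately show "\<exists>g. transfer_function G j \<sigma> = Some g \<and> transfer_function ?R j \<sigma> = Some g"
    by simp
qed

end
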